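(* For every integer $n\ge2$, the affine Eulerian polynomial of type $B$, $\widetilde{B}_n(x)=\sum_{\sigma\in\mathfrak{B}_n}x^{\widetilde{\operatorname{des}}_B\sigma}$, has only real roots.
   Context: $\mathfrak{B}_n$ is the set of signed permutations of $\{1,\dots,n\}$, i.e. sequences $\sigma=(\sigma_1,\dots,\sigma_n)$ of nonzero integers such that $(|\sigma_1|,\dots,|\sigma_n|)$ is a permutation of $\{1,\dots,n\}$. For $\sigma\in\mathfrak{B}_n$ ($n\ge 2$) and the usual order of the integers, $\widetilde{\operatorname{des}}_B\sigma=\chi(\sigma_1<0)+|\{1\le i\le n-1\mid\sigma_i>\sigma_{i+1}\}|+\chi(\sigma_{n-1}+\sigma_n>0)$, where $\chi(\varphi)=1$ if $\varphi$ is true and $0$ otherwise. A polynomial "has only real roots" if all its complex roots are real. *)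

theory Defs
  imports
    "HOL-Combinatorics.Multiset_Permutations"
    "HOL-Computational_Algebra.Polynomial"
    Complex_Main
begin

text \<open>
  A signed permutation is its window \<open>(\<sigma>\<^sub>1, \<dots>, \<sigma>\<^sub>n)\<close>, given as an integer list. List indices
  start at 0, so \<open>\<sigma>\<^sub>i\<close> is \<open>\<sigma> ! (i - 1)\<close>. The entries are nonzero and the length is \<open>n\<close>
  because the list of absolute values enumerates \<open>{1..n}\<close> without repetition.
\<close>

definition signed_permutations :: "nat \<Rightarrow> int list set" where
  "signed_permutations n = {\<sigma>. map abs \<sigma> \<in> permutations_of_set {1..int n}}"

text \<open>
  The affine type-B descent number; meaningful only for windows of length at least 2.
\<close>

definition affine_des_B :: "int list \<Rightarrow> nat" where
  "affine_des_B \<sigma> = (let n = length \<sigma> in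
     of_bool (\<sigma> ! 0 < 0)
     + card {i \<in> {1..n - 1}. \<sigma> ! (i - 1) > \<sigma> ! i}
     + of_bool (\<sigma> ! (n - 2) + \<sigma> ! (n - 1) > 0))"

definition affine_eulerian_B :: "nat \<Rightarrow> real poly" where
  "affine_eulerian_B n = (\<Sum>\<sigma>\<in>signed_permutations n. monom 1 (affine_des_B \<sigma>))"

definition has_only_real_roots :: "real poly \<Rightarrow> bool" where
  "has_only_real_roots p \<longleftrightarrow>
     (\<forall>z::complex. poly (map_poly complex_of_real p) z = 0 \<longrightarrow> z \<in> \<real>)"

end

theory Submission
  imports Defs
begin

text \<open>
  Splitting a signed permutation into its first entry and the rest, the sums \<open>f\<^sub>k\<close> of \<open>x\<close> to the
  number of remaining affine descents over all \<open>\<sigma>\<close> with first entry \<open>k\<close> satisfy a recurrence in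
  which each new polynomial is \<open>x\<close> times the sum of an initial part of the old sequence plus the
  sum of the rest, and the affine Eulerian polynomial is itself such a sum. At a point \<open>z\<close> of the open
  upper half-plane, interlacing \<open>f \<lless> g\<close> of polynomials with nonnegative coefficients says that
  \<open>g(z) / f(z)\<close> lies in the sector of arguments between \<open>0\<close> and \<open>arg z\<close>. Cleared of
  denominators, this consists of two inequalities that are biadditive in \<open>f\<close> and \<open>g\<close>, so it is
  pairwise preserved by the recurrence, and it prevents the sums from vanishing at \<open>z\<close>. The
  sequence is pairwise interlacing only from \<open>n = 4\<close> on; there it is checked by Bezoutians, and
  \<open>n = 2, 3\<close> are treated directly.
\<close>

subsection \<open>Interlacing at a point of the upper half-plane\<close>

text \<open>For nonzero \<open>f\<close> and \<open>g\<close> the two conditions are Im (g/f) \<ge>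
  0 and Im (z f/g) \<ge> 0, freed of division. The value 0 is related to everything, so nonvanishing
  has to be carried separately.\<close>

definition interlace_at :: "complex \<Rightarrow> complex \<Rightarrow> complex \<Rightarrow> bool" where
  "interlace_at z f g \<longleftrightarrow> 0 \<le> Im (g * cnj f) \<and> 0 \<le> Im (z * f * cnj g)"

lemma interlace_at_refl: "0 \<le> Im z \<Longrightarrow> interlace_at z f f"
  by (simp add: interlace_at_def mult.assoc complex_mult_cnj flip: of_real_power of_real_add)

lemma interlace_at_sum:
  assumes "\<And>i j. i \<in> I \<Longrightarrow> j \<in> J \<Longrightarrow> interlace_at z (f i) (f j)"
  shows "interlace_at z (\<Sum>i\<in>I. f i) (\<Sum>j\<in>J. f j)"
  using assms unfolding interlace_at_def
  by (auto simp: sum_distrib_left sum_distrib_right cnj_sum Im_sum intro!: sum_nonneg)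

lemma interlace_at_step:
  assumes z: "0 \<le> Im z"
    and ab: "interlace_at z a b" and bc: "interlace_at z b c" and ac: "interlace_at z a c"
  shows "interlace_at z (z * a + b + c) (z * a + z * b + c)"
proof -
  \<comment> \<open>With u = z a + c the two combinations are u + b and u + z b. Expanding around u
    leaves squared moduli times Im z and nonnegative multiples of the given forms.\<close>
  have "Im ((z * a + z * b + c) * cnj (z * a + b + c)) =
      Im (z * a * cnj b) + (cmod z)\<^sup>2 * Im (b * cnj a) + Im z * (cmod b)\<^sup>2
      + Im (z * b * cnj c) + Im (c * cnj b)"
    unfolding cmod_power2 by (simp add: algebra_simps power2_eq_square)
  moreover have "Im (z * (z * a + b + c) * cnj (z * a + z * b + c)) =
      Im z * (cmod (z * a + c))\<^sup>2 + (cmod z)\<^sup>2 * Im (z * a * cnj b) + (cmod z)\<^sup>2 * Im (b * cnj a)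
      + Im (z * b * cnj c) + (cmod z)\<^sup>2 * Im (c * cnj b)"
    unfolding cmod_power2 by (simp add: algebra_simps power2_eq_square)
  ultimately show ?thesis
    using assms unfolding interlace_at_def by simp
qed

section \<open>Sums with a factor \<open>z\<close> on an initial part: interlacing and
  nonvanishing\<close>

definition threshold_sum :: "complex \<Rightarrow> ('a \<Rightarrow> complex) \<Rightarrow> 'a set \<Rightarrow> 'a set \<Rightarrow> complex" where
  "threshold_sum z f I D = z * (\<Sum>i\<in>D. f i) + (\<Sum>i\<in>I - D. f i)"

lemma threshold_sum_if:
  assumes "finite I"
  shows "threshold_sum z f I {k \<in> I. P k} = (\<Sum>k\<in>I. if P k then z * f k else f k)"
proof -
  have "I \<inter> {k. P k} = {k \<in> I. P k}" "I \<inter> - {k. P k} = I - {k \<in> I. P k}" by auto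
  then show ?thesis
    using assms by (simp add: sum.If_cases threshold_sum_def sum_distrib_left)
qed

text \<open>The blocks \<open>D\<close>, \<open>E - D\<close> and \<open>I - E\<close> follow each
  other in the order, so their sums interlace pairwise; the two threshold sums differ only by the
  factor \<open>z\<close> on the middle block, as in \<open>interlace_at_step\<close>.\<close>

lemma interlace_at_threshold_sum:
  fixes f :: "'a :: linorder \<Rightarrow> complex"
  assumes z: "0 \<le> Im z" and fin: "finite I" and DE: "D \<subseteq> E" "E \<subseteq> I"
    and chain: "\<And>i j. i \<in> I \<Longrightarrow> j \<in> I \<Longrightarrow> i \<le> j \<Longrightarrow> interlace_at z (f i) (f j)"
    and lower: "\<And>i j. i \<in> D \<Longrightarrow> j \<in> I - D \<Longrightarrow> i \<le> j" "\<And>i j. i \<in> E \<Longrightarrow> j \<in> I - E \<Longrightarrow> i \<le> j"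
  shows "interlace_at z (threshold_sum z f I D) (threshold_sum z f I E)"
proof -
  have "finite E" using fin DE finite_subset by blast
  then have E: "sum f E = sum f D + sum f (E - D)"
    using DE by (metis add.commute sum.subset_diff)
  have "sum f (I - D) = sum f (E - D) + sum f (I - E)"
    using fin DE by (subst sum.union_disjoint [symmetric]) (auto intro!: sum.cong finite_subset [OF _ fin])
  then have "threshold_sum z f I D = z * sum f D + sum f (E - D) + sum f (I - E)"
    "threshold_sum z f I E = z * sum f D + z * sum f (E - D) + sum f (I - E)"
    unfolding threshold_sum_def E by (simp_all add: algebra_simps)
  moreover have "interlace_at z (sum f D) (sum f (E - D))" "interlace_at z (sum f (E - D)) (sum f (I - E))"
    "interlace_at z (sum f D) (sum f (I - E))"
    using DE lower by (auto intro!: interlace_at_sum chain)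
  ultimately show ?thesis
    using interlace_at_step [OF z] by metis
qed

text \<open>The sum of the two forms against \<open>f m\<close> is a real-linear functional that is
  nonnegative on every summand and positive on \<open>f m\<close> itself, so it cannot vanish on the
  total.\<close>

lemma sum_nonzero_of_interlace_at:
  assumes z: "0 < Im z" and fin: "finite I" and m: "m \<in> I" and nz: "f m \<noteq> 0"
    and il: "\<And>i. i \<in> I \<Longrightarrow> interlace_at z (f m) (f i)"
  shows "(\<Sum>i\<in>I. f i) \<noteq> 0"
proof
  define \<phi> where "\<phi> w = Im (w * cnj (f m)) + Im (z * f m * cnj w)" for w
  assume "(\<Sum>i\<in>I. f i) = 0"
  then have "\<phi> (\<Sum>i\<in>I. f i) = 0"
    by (simp add: \<phi>_def)
  also have "\<phi> (\<Sum>i\<in>I. f i) = (\<Sum>i\<in>I. \<phi> (f i))"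
    unfolding \<phi>_def
    by (simp add: sum_distrib_left sum_distrib_right cnj_sum Im_sum sum.distrib)
  finally have "\<phi> (f m) = 0"
    using il m fin by (subst (asm) sum_nonneg_eq_0_iff) (auto simp: \<phi>_def interlace_at_def)
  moreover have "\<phi> (f m) = Im z * (cmod (f m))\<^sup>2"
    unfolding \<phi>_def cmod_power2 by (simp add: algebra_simps power2_eq_square)
  ultimately show False
    using z nz by simp
qed

text \<open>If z a + c = 0 for the two block sums, multiplying by the conjugate of a gives Im z
  |a|^2 + Im (c \<open>cnj\<close> a) = 0, although the first term is positive and the second
  nonnegative.\<close>

lemma threshold_sum_nonzero:
  assumes z: "0 < Im z" and fin: "finite I" and D: "D \<subseteq> I" and m: "m \<in> D" and nz: "f m \<noteq> 0"
    and il: "\<And>i. i \<in> I \<Longrightarrow> interlace_at z (f m) (f i)"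
    and cross: "\<And>i j. i \<in> D \<Longrightarrow> j \<in> I - D \<Longrightarrow> interlace_at z (f i) (f j)"
  shows "threshold_sum z f I D \<noteq> 0"
proof
  define a c where "a = (\<Sum>i\<in>D. f i)" and "c = (\<Sum>i\<in>I - D. f i)"
  assume "threshold_sum z f I D = 0"
  then have "z * a + c = 0"
    by (simp add: threshold_sum_def a_def c_def)
  then have "Im ((z * a + c) * cnj a) = 0" by simp
  moreover have "Im ((z * a + c) * cnj a) = Im z * (cmod a)\<^sup>2 + Im (c * cnj a)"
    unfolding cmod_power2 by (simp add: algebra_simps power2_eq_square)
  moreover have "interlace_at z a c"
    unfolding a_def c_def using cross by (intro interlace_at_sum) auto
  moreover have "a \<noteq> 0"
    unfolding a_def using z m nz il D by (intro sum_nonzero_of_interlace_at [of z _ m]) (auto intro: finite_subset [OF _ fin])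
  ultimately show False
    using z unfolding interlace_at_def by (smt (verit) mult_pos_pos zero_less_norm_iff zero_less_power)
qed

subsection \<open>Bezoutians of cubic polynomials\<close>

definition cubic :: "real \<Rightarrow> real \<Rightarrow> real \<Rightarrow> real \<Rightarrow> complex \<Rightarrow> complex" where
  "cubic a\<^sub>0 a\<^sub>1 a\<^sub>2 a\<^sub>3 z = of_real a\<^sub>0 + of_real a\<^sub>1 * z + of_real a\<^sub>2 * z ^ 2 + of_real a\<^sub>3 * z ^ 3"

text \<open>This is the Hermitian form with rows (u, v), (v, w) at the vector (1, x + i y). For w >
  0 complete the square; w = 0 forces v = 0.\<close>

lemma binary_form_nonneg:
  fixes u v w x y :: real
  assumes "0 \<le> u" "0 \<le> w" "v\<^sup>2 \<le> u * w"
  shows "0 \<le> u + 2 * v * x + w * (x\<^sup>2 + y\<^sup>2)"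
proof (cases "w = 0")
  case False
  have "w * (u + 2 * v * x + w * (x\<^sup>2 + y\<^sup>2)) = (w * x + v)\<^sup>2 + (u * w - v\<^sup>2) + (w * y)\<^sup>2"
    by algebra
  also have "\<dots> \<ge> 0" using assms by simp
  finally show ?thesis using False assms by (simp add: zero_le_mult_iff)
qed (use assms in simp)

text \<open>With z = x + i y this is a Hermitian form at (1, z, z^2). Multiplied by
  \<open>m\<^sub>0\<close>, it is |\<open>m\<^sub>0\<close> + \<open>m\<^sub>1\<close> z +
  \<open>m\<^sub>2\<close> z^2|^2 plus |z|^2 times the binary form of the Schur complement.\<close>

lemma ternary_form_nonneg:
  fixes m\<^sub>0 m\<^sub>1 m\<^sub>2 m\<^sub>3 m\<^sub>4 m\<^sub>5 x y :: real
  assumes "0 < m\<^sub>0" "0 \<le> m\<^sub>0 * m\<^sub>3 - m\<^sub>1\<^sup>2" "0 \<le> m\<^sub>0 * m\<^sub>5 - m\<^sub>2\<^sup>2"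
    "(m\<^sub>0 * m\<^sub>4 - m\<^sub>1 * m\<^sub>2)\<^sup>2 \<le> (m\<^sub>0 * m\<^sub>3 - m\<^sub>1\<^sup>2) * (m\<^sub>0 * m\<^sub>5 - m\<^sub>2\<^sup>2)"
  shows "0 \<le> m\<^sub>0 + 2 * m\<^sub>1 * x + 2 * m\<^sub>2 * (x\<^sup>2 - y\<^sup>2) + (m\<^sub>3 + 2 * m\<^sub>4 * x + m\<^sub>5 * (x\<^sup>2 + y\<^sup>2)) * (x\<^sup>2 + y\<^sup>2)"
    (is "0 \<le> ?F")
proof -
  have "0 \<le> ((m\<^sub>0 * m\<^sub>3 - m\<^sub>1\<^sup>2) + 2 * (m\<^sub>0 * m\<^sub>4 - m\<^sub>1 * m\<^sub>2) * x
      + (m\<^sub>0 * m\<^sub>5 - m\<^sub>2\<^sup>2) * (x\<^sup>2 + y\<^sup>2)) * (x\<^sup>2 + y\<^sup>2)"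
    by (intro mult_nonneg_nonneg binary_form_nonneg assms) simp
  note nonneg = add_nonneg_nonneg [OF add_nonneg_nonneg [OF zero_le_power2 zero_le_power2] this]
  have "m\<^sub>0 * ?F = (m\<^sub>0 + m\<^sub>1 * x + m\<^sub>2 * (x\<^sup>2 - y\<^sup>2))\<^sup>2 + (m\<^sub>1 * y + 2 * m\<^sub>2 * x * y)\<^sup>2
      + ((m\<^sub>0 * m\<^sub>3 - m\<^sub>1\<^sup>2) + 2 * (m\<^sub>0 * m\<^sub>4 - m\<^sub>1 * m\<^sub>2) * x + (m\<^sub>0 * m\<^sub>5 - m\<^sub>2\<^sup>2) * (x\<^sup>2 + y\<^sup>2)) * (x\<^sup>2 + y\<^sup>2)"
    by algebra
  also have "\<dots> \<ge> 0"
    by (rule nonneg)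
  finally show ?thesis using assms by (simp add: zero_le_mult_iff)
qed

text \<open>
  The Bezout matrix of the two cubics has the upper triangle \<open>m\<^sub>0, m\<^sub>1, m\<^sub>2; m\<^sub>3, m\<^sub>4; m\<^sub>5\<close>; it is positive
  semidefinite if \<open>m\<^sub>0 > 0\<close> and its Schur complement with respect to \<open>m\<^sub>0\<close> is.
\<close>

definition bezoutian_nonneg :: "real \<Rightarrow> real \<Rightarrow> real \<Rightarrow> real \<Rightarrow> real \<Rightarrow> real \<Rightarrow> real \<Rightarrow> real \<Rightarrow> bool" where
  "bezoutian_nonneg a\<^sub>0 a\<^sub>1 a\<^sub>2 a\<^sub>3 b\<^sub>0 b\<^sub>1 b\<^sub>2 b\<^sub>3 \<longleftrightarrow>
    (let m\<^sub>0 = b\<^sub>1 * a\<^sub>0 - b\<^sub>0 * a\<^sub>1; m\<^sub>1 = b\<^sub>2 * a\<^sub>0 - b\<^sub>0 * a\<^sub>2; m\<^sub>2 = b\<^sub>3 * a\<^sub>0 - b\<^sub>0 * a\<^sub>3;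
         m\<^sub>3 = m\<^sub>2 + b\<^sub>2 * a\<^sub>1 - b\<^sub>1 * a\<^sub>2; m\<^sub>4 = b\<^sub>3 * a\<^sub>1 - b\<^sub>1 * a\<^sub>3; m\<^sub>5 = b\<^sub>3 * a\<^sub>2 - b\<^sub>2 * a\<^sub>3
     in 0 < m\<^sub>0 \<and> 0 \<le> m\<^sub>0 * m\<^sub>3 - m\<^sub>1\<^sup>2 \<and> 0 \<le> m\<^sub>0 * m\<^sub>5 - m\<^sub>2\<^sup>2 \<and>
       (m\<^sub>0 * m\<^sub>4 - m\<^sub>1 * m\<^sub>2)\<^sup>2 \<le> (m\<^sub>0 * m\<^sub>3 - m\<^sub>1\<^sup>2) * (m\<^sub>0 * m\<^sub>5 - m\<^sub>2\<^sup>2))"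

text \<open>The Bezout form is (B(z) A(w) - B(w) A(z)) / (z - w). At w = \<open>cnj z\<close> the
  numerator is 2 i times the imaginary part in question and the denominator is 2 i Im z.\<close>

lemma Im_cubic_nonneg:
  assumes z: "0 \<le> Im z" and "bezoutian_nonneg a\<^sub>0 a\<^sub>1 a\<^sub>2 a\<^sub>3 b\<^sub>0 b\<^sub>1 b\<^sub>2 b\<^sub>3"
  shows "0 \<le> Im (cubic b\<^sub>0 b\<^sub>1 b\<^sub>2 b\<^sub>3 z * cnj (cubic a\<^sub>0 a\<^sub>1 a\<^sub>2 a\<^sub>3 z))"
proof -
  obtain x y where xy: "z = Complex x y" by (cases z)
  define m\<^sub>0 m\<^sub>1 m\<^sub>2 where "m\<^sub>0 = b\<^sub>1 * a\<^sub>0 - b\<^sub>0 * a\<^sub>1" and "m\<^sub>1 = b\<^sub>2 * a\<^sub>0 - b\<^sub>0 * a\<^sub>2" and "m\<^sub>2 = b\<^sub>3 * a\<^sub>0 - b\<^sub>0 * a\<^sub>3"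
  define m\<^sub>3 m\<^sub>4 m\<^sub>5 where "m\<^sub>3 = m\<^sub>2 + b\<^sub>2 * a\<^sub>1 - b\<^sub>1 * a\<^sub>2" and "m\<^sub>4 = b\<^sub>3 * a\<^sub>1 - b\<^sub>1 * a\<^sub>3" and "m\<^sub>5 = b\<^sub>3 * a\<^sub>2 - b\<^sub>2 * a\<^sub>3"
  note m_defs = m\<^sub>0_def m\<^sub>1_def m\<^sub>2_def m\<^sub>3_def m\<^sub>4_def m\<^sub>5_def
  have "Im (cubic b\<^sub>0 b\<^sub>1 b\<^sub>2 b\<^sub>3 z * cnj (cubic a\<^sub>0 a\<^sub>1 a\<^sub>2 a\<^sub>3 z)) =
      y * (m\<^sub>0 + 2 * m\<^sub>1 * x + 2 * m\<^sub>2 * (x\<^sup>2 - y\<^sup>2) + (m\<^sub>3 + 2 * m\<^sub>4 * x + m\<^sub>5 * (x\<^sup>2 + y\<^sup>2)) * (x\<^sup>2 + y\<^sup>2))"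
    unfolding cubic_def xy m_defs by (simp add: power2_eq_square power3_eq_cube) algebra
  moreover have "0 \<le> m\<^sub>0 + 2 * m\<^sub>1 * x + 2 * m\<^sub>2 * (x\<^sup>2 - y\<^sup>2) + (m\<^sub>3 + 2 * m\<^sub>4 * x + m\<^sub>5 * (x\<^sup>2 + y\<^sup>2)) * (x\<^sup>2 + y\<^sup>2)"
    using assms(2) unfolding bezoutian_nonneg_def Let_def m_defs by (intro ternary_form_nonneg) simp_all
  ultimately show ?thesis
    using z by (simp add: xy)
qed

lemma cubic_shift: "cubic 0 a\<^sub>0 a\<^sub>1 a\<^sub>2 z = z * cubic a\<^sub>0 a\<^sub>1 a\<^sub>2 0 z"
  by (simp add: cubic_def algebra_simps power2_eq_square power3_eq_cube)

lemma Im_scaled: "Im (z * f * cnj (z * g)) = (cmod z)\<^sup>2 * Im (f * cnj g)"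
  unfolding cmod_power2 by (simp add: algebra_simps power2_eq_square)

text \<open>The second cubic is divisible by \<open>z\<close>, so in the second form the factor
  \<open>z\<close> cancels up to |z|^2; this turns both forms into Bezoutians of cubics.\<close>

lemma interlace_at_cubic:
  assumes "0 \<le> Im z" "bezoutian_nonneg a\<^sub>0 a\<^sub>1 a\<^sub>2 a\<^sub>3 0 b\<^sub>0 b\<^sub>1 b\<^sub>2" "bezoutian_nonneg b\<^sub>0 b\<^sub>1 b\<^sub>2 0 a\<^sub>0 a\<^sub>1 a\<^sub>2 a\<^sub>3"
  shows "interlace_at z (cubic a\<^sub>0 a\<^sub>1 a\<^sub>2 a\<^sub>3 z) (cubic 0 b\<^sub>0 b\<^sub>1 b\<^sub>2 z)"
  using Im_cubic_nonneg [OF assms(1,2)] Im_cubic_nonneg [OF assms(1,3)]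
  unfolding interlace_at_def cubic_shift Im_scaled by simp

text \<open>Passing from (f, g) to (g, z f) exchanges the two conditions up to the factor
  |z|^2.\<close>

lemma interlace_at_shifted:
  assumes "interlace_at z f g"
  shows "interlace_at z g (z * f)"
  using assms Im_scaled [of z g f] unfolding interlace_at_def by (simp add: mult.assoc)

lemma interlace_at_mult:
  assumes "interlace_at z f g"
  shows "interlace_at z (z * f) (z * g)"
  using assms Im_scaled [of z g f] Im_scaled [of z "z * f" g] unfolding interlace_at_def by (simp add: mult.assoc)

text \<open>Both cubics are first divided by \<open>z\<close>: with two vanishing constant terms
  \<open>m\<^sub>0\<close> would be 0, while the Bezoutian test asks for a positive one.\<close>

lemma interlace_at_quadratic:
  assumes "0 \<le> Im z" "bezoutian_nonneg a\<^sub>0 a\<^sub>1 a\<^sub>2 0 b\<^sub>0 b\<^sub>1 b\<^sub>2 0" "bezoutian_nonneg b\<^sub>0 b\<^sub>1 b\<^sub>2 0 0 a\<^sub>0 a\<^sub>1 a\<^sub>2"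
  shows "interlace_at z (cubic 0 a\<^sub>0 a\<^sub>1 a\<^sub>2 z) (cubic 0 b\<^sub>0 b\<^sub>1 b\<^sub>2 z)"
  unfolding cubic_shift
  by (rule interlace_at_mult)
    (use Im_cubic_nonneg [OF assms(1,2)] Im_cubic_nonneg [OF assms(1,3)] in
      \<open>simp add: interlace_at_def cubic_shift del: times_complex.simps\<close>)

subsection \<open>Splitting off the first entry of a signed permutation\<close>

text \<open>The affine descent number without the sign of the first entry, which is the part that
  obeys a recurrence when the first entry is removed.\<close>

definition tail_des :: "int list \<Rightarrow> nat" where
  "tail_des \<sigma> = (let n = length \<sigma> in
     card {i \<in> {1..n - 1}. \<sigma> ! (i - 1) > \<sigma> ! i} + of_bool (\<sigma> ! (n - 2) + \<sigma> ! (n - 1) > 0))"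

lemma affine_des_B_eq: "affine_des_B \<sigma> = of_bool (\<sigma> ! 0 < 0) + tail_des \<sigma>"
  by (simp add: affine_des_B_def tail_des_def Let_def)

lemma card_descents_Cons:
  assumes "\<sigma> \<noteq> []"
  shows "card {i \<in> {1..length \<sigma>}. (k # \<sigma>) ! (i - 1) > (k # \<sigma>) ! i} =
     of_bool (k > hd \<sigma>) + card {i \<in> {1..length \<sigma> - 1}. \<sigma> ! (i - 1) > \<sigma> ! i}"
proof -
  have "{i \<in> {1..length \<sigma>}. (k # \<sigma>) ! (i - 1) > (k # \<sigma>) ! i} =
     (if k > hd \<sigma> then {1} else {}) \<union> Suc ` {i \<in> {1..length \<sigma> - 1}. \<sigma> ! (i - 1) > \<sigma> ! i}" (is "?L = ?A \<union> Suc ` ?B")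
  proof (intro set_eqI)
    fix i
    show "i \<in> ?L \<longleftrightarrow> i \<in> ?A \<union> Suc ` ?B"
      using assms by (cases i; cases "i - 1") (auto simp: hd_conv_nth image_iff Suc_le_eq)
  qed
  moreover have "card (?A \<union> Suc ` ?B) = card ?A + card ?B"
    by (subst card_Un_disjoint) (auto simp: card_image)
  ultimately show ?thesis by simp
qed

lemma tail_des_Cons:
  assumes "length \<sigma> \<ge> 2"
  shows "tail_des (k # \<sigma>) = of_bool (k > hd \<sigma>) + tail_des \<sigma>"
proof -
  have "\<sigma> \<noteq> []" using assms by auto
  from card_descents_Cons [OF this, of k] assms show ?thesis
    by (auto simp: tail_des_def Let_def nth_Cons' Suc_diff_Suc numeral_2_eq_2)
qed

lemma tail_des_pair: "tail_des [a, b] = of_bool (a > b) + of_bool (a + b > 0)"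
  using card_descents_Cons [of "[b]" a] by (simp add: tail_des_def del: One_nat_def)

text \<open>The condition x + y > 0 is the comparison - y < x, which an odd increasing map preserves
  just like the descents.\<close>

lemma tail_des_map:
  assumes mono: "strict_mono f" and odd: "\<And>x. f (- x) = - f x" and len: "length \<sigma> \<ge> 2"
  shows "tail_des (map f \<sigma>) = tail_des \<sigma>"
proof -
  have less: "f x < f y \<longleftrightarrow> x < y" for x y using mono by (simp add: strict_mono_less)
  have "f x + f y > 0 \<longleftrightarrow> x + y > 0" for x y
    using less [of "- y" x] odd by auto
  moreover have "{i \<in> {1..length \<sigma> - 1}. map f \<sigma> ! (i - 1) > map f \<sigma> ! i} = {i \<in> {1..length \<sigma> - 1}. \<sigma> ! (i - 1) > \<sigma> ! i}"
    using less by auto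
  ultimately show ?thesis
    using len by (simp add: tail_des_def Let_def)
qed

text \<open>Inverse of standardization: it makes room for \<open>\<plusminus>k\<close> among the values \<open>\<plusminus>1, \<dots>, \<plusminus>n\<close>.\<close>

definition lift :: "int \<Rightarrow> int \<Rightarrow> int" where
  "lift k l = (if \<bar>l\<bar> < \<bar>k\<bar> then l else l + sgn l)"

lemma lift_minus: "lift k (- l) = - lift k l"
  by (simp add: lift_def)

lemma strict_mono_lift: "k \<noteq> 0 \<Longrightarrow> strict_mono (lift k)"
  by (auto simp: strict_mono_def lift_def sgn_if abs_if)

lemma abs_lift: "k \<noteq> 0 \<Longrightarrow> \<bar>lift k l\<bar> = lift k \<bar>l\<bar>"
  by (auto simp: lift_def sgn_if abs_if)

lemma lift_image:
  assumes "1 \<le> \<bar>k\<bar>" "\<bar>k\<bar> \<le> int (Suc n)"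
  shows "lift k ` {1..int n} = {1..int (Suc n)} - {\<bar>k\<bar>}"
proof (intro subset_antisym subsetI)
  fix x assume x: "x \<in> {1..int (Suc n)} - {\<bar>k\<bar>}"
  show "x \<in> lift k ` {1..int n}"
  proof (cases "x < \<bar>k\<bar>")
    case True
    then show ?thesis using x assms by (intro image_eqI [of _ _ x]) (auto simp: lift_def)
  next
    case False
    then show ?thesis using x assms by (intro image_eqI [of _ _ "x - 1"]) (auto simp: lift_def sgn_if)
  qed
qed (use assms in \<open>auto simp: lift_def sgn_if\<close>)

text \<open>The tie l = k is pushed away from 0: below a negative \<open>k\<close>, but above a
  positive one.\<close>

lemma less_lift_iff: "k \<noteq> 0 \<Longrightarrow> l \<noteq> 0 \<Longrightarrow> lift k l < k \<longleftrightarrow> l < k \<or> l = k \<and> k < 0"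
  by (auto simp: lift_def sgn_if abs_if)

lemma signed_permutations_length: "\<sigma> \<in> signed_permutations n \<Longrightarrow> length \<sigma> = n"
  unfolding signed_permutations_def using length_finite_permutations_of_set [of "map abs \<sigma>"] by auto

lemma finite_signed_permutations: "finite (signed_permutations n)"
proof (rule finite_subset)
  show "signed_permutations n \<subseteq> {\<sigma>. set \<sigma> \<subseteq> {- int n..int n} \<and> length \<sigma> = n}"
  proof (intro subsetI CollectI conjI)
    fix \<sigma> x assume "\<sigma> \<in> signed_permutations n" "x \<in> set \<sigma>"
    then have "\<bar>x\<bar> \<in> {1..int n}"
      by (auto simp: signed_permutations_def permutations_of_set_def)
    then show "x \<in> {- int n..int n}" by auto
  qed (simp add: signed_permutations_length)
  show "finite {\<sigma>. set \<sigma> \<subseteq> {- int n..int n} \<and> length \<sigma> = n}"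
    by (rule finite_lists_length_eq) simp
qed

text \<open>On absolute values, \<open>lift k\<close> maps {1..n} onto {1..n+1} without |k|; since
  it is odd, the signs can be put back.\<close>

lemma Cons_in_signed_permutations_iff:
  assumes k: "1 \<le> \<bar>k\<bar>" "\<bar>k\<bar> \<le> int (Suc n)"
  shows "k # \<sigma> \<in> signed_permutations (Suc n) \<longleftrightarrow> \<sigma> \<in> map (lift k) ` signed_permutations n"
proof -
  have k0: "k \<noteq> 0" using k by auto
  have inj: "inj (lift k)" using strict_mono_lift [OF k0] by (rule strict_mono_imp_inj_on)
  have "k # \<sigma> \<in> signed_permutations (Suc n) \<longleftrightarrow> map abs \<sigma> \<in> permutations_of_set ({1..int (Suc n)} - {\<bar>k\<bar>})"
    using k unfolding signed_permutations_def permutations_of_set_def by (auto dest: sym)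
  also have "\<dots> \<longleftrightarrow> map abs \<sigma> \<in> map (lift k) ` permutations_of_set {1..int n}"
    by (simp only: lift_image [OF k, symmetric] permutations_of_set_image_inj [OF inj_on_subset [OF inj subset_UNIV]])
  also have "\<dots> \<longleftrightarrow> \<sigma> \<in> map (lift k) ` signed_permutations n"
  proof
    assume "map abs \<sigma> \<in> map (lift k) ` permutations_of_set {1..int n}"
    then obtain \<rho> where \<rho>: "map abs \<sigma> = map (lift k) \<rho>" "\<rho> \<in> permutations_of_set {1..int n}" by auto
    have "x \<in> range (lift k)" if "x \<in> set \<sigma>" for x
    proof -
      have "\<bar>x\<bar> \<in> set (map abs \<sigma>)" using that by simp
      then obtain a where "\<bar>x\<bar> = lift k a" unfolding \<rho>(1) by auto
      then have "x = lift k a \<or> x = lift k (- a)" by (auto simp: lift_minus abs_if split: if_splits)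
      then show ?thesis by auto
    qed
    then have "\<sigma> \<in> lists (range (lift k))" by auto
    then obtain \<tau> where \<tau>: "\<sigma> = map (lift k) \<tau>" by (auto simp: lists_image)
    then have "map (lift k) (map abs \<tau>) = map (lift k) \<rho>"
      using \<rho> by (simp add: abs_lift [OF k0] comp_def)
    then have "map abs \<tau> = \<rho>" using inj by (simp only: inj_map_eq_map)
    then show "\<sigma> \<in> map (lift k) ` signed_permutations n"
      using \<tau> \<rho> by (auto simp: signed_permutations_def)
  next
    assume "\<sigma> \<in> map (lift k) ` signed_permutations n"
    then obtain \<tau> where "\<sigma> = map (lift k) \<tau>" "map abs \<tau> \<in> permutations_of_set {1..int n}"
      by (auto simp: signed_permutations_def)
    then show "map abs \<sigma> \<in> map (lift k) ` permutations_of_set {1..int n}"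
      by (intro image_eqI [of _ _ "map abs \<tau>"]) (auto simp: abs_lift [OF k0])
  qed
  finally show ?thesis .
qed

section \<open>The recurrence for sums over windows with a given first entry\<close>

definition heads :: "nat \<Rightarrow> int set" where
  "heads n = {k. 1 \<le> \<bar>k\<bar> \<and> \<bar>k\<bar> \<le> int n}"

lemma finite_heads [simp]: "finite (heads n)"
  by (rule finite_subset [of _ "{- int n..int n}"]) (auto simp: heads_def)

lemma hd_signed_permutations:
  assumes "\<sigma> \<in> signed_permutations n" "n > 0"
  shows "hd \<sigma> \<in> heads n"
proof -
  have "hd \<sigma> \<in> set \<sigma>" using signed_permutations_length assms by fastforce
  then show ?thesis using assms by (auto simp: heads_def signed_permutations_def permutations_of_set_def)
qed

definition head_poly :: "complex \<Rightarrow> nat \<Rightarrow> int \<Rightarrow> complex" where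
  "head_poly z n k = (\<Sum>\<sigma> | \<sigma> \<in> signed_permutations n \<and> hd \<sigma> = k. z ^ tail_des \<sigma>)"

text \<open>Serves twice: with the descent condition at the first position it gives the recurrence,
  with negativity of the first entry the affine Eulerian polynomial.\<close>

lemma sum_by_head:
  assumes "n > 0"
  shows "(\<Sum>\<sigma>\<in>signed_permutations n. z ^ (of_bool (P (hd \<sigma>)) + tail_des \<sigma>)) =
    threshold_sum z (head_poly z n) (heads n) {k \<in> heads n. P k}"
proof -
  let ?w = "\<lambda>k. if P k then z else 1"
  have "(\<Sum>\<sigma>\<in>signed_permutations n. z ^ (of_bool (P (hd \<sigma>)) + tail_des \<sigma>)) =
    (\<Sum>k\<in>heads n. \<Sum>\<sigma> | \<sigma> \<in> signed_permutations n \<and> hd \<sigma> = k. z ^ (of_bool (P (hd \<sigma>)) + tail_des \<sigma>))"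
    using hd_signed_permutations assms
    by (intro sum.group [symmetric] finite_signed_permutations) auto
  also have "\<dots> = (\<Sum>k\<in>heads n. ?w k * head_poly z n k)"
    by (intro sum.cong refl) (auto simp: head_poly_def sum_distrib_left intro!: sum.cong)
  also have "\<dots> = (\<Sum>k\<in>heads n. if P k then z * head_poly z n k else head_poly z n k)"
    by (intro sum.cong) auto
  also have "\<dots> = threshold_sum z (head_poly z n) (heads n) {k \<in> heads n. P k}"
    by (simp add: threshold_sum_if)
  finally show ?thesis .
qed

lemma head_poly_reindex:
  assumes "k \<in> heads (Suc n)"
  shows "head_poly z (Suc n) k = (\<Sum>\<tau>\<in>signed_permutations n. z ^ tail_des (k # map (lift k) \<tau>))"
proof -
  have k: "1 \<le> \<bar>k\<bar>" "\<bar>k\<bar> \<le> int (Suc n)" using assms by (auto simp: heads_def)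
  have inj: "inj (lift k)" using strict_mono_lift [of k] k by (intro strict_mono_imp_inj_on) auto
  have "{\<sigma>. \<sigma> \<in> signed_permutations (Suc n) \<and> hd \<sigma> = k} = (\<lambda>\<tau>. k # map (lift k) \<tau>) ` signed_permutations n"
  proof (intro set_eqI)
    fix \<sigma>
    show "\<sigma> \<in> {\<sigma>. \<sigma> \<in> signed_permutations (Suc n) \<and> hd \<sigma> = k} \<longleftrightarrow> \<sigma> \<in> (\<lambda>\<tau>. k # map (lift k) \<tau>) ` signed_permutations n"
      using Cons_in_signed_permutations_iff [OF k] signed_permutations_length [of \<sigma> "Suc n"]
      by (cases \<sigma>) auto
  qed
  moreover have "inj_on (\<lambda>\<tau>. k # map (lift k) \<tau>) (signed_permutations n)"
    using inj by (auto simp: inj_on_def inj_map_eq_map)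
  ultimately show ?thesis
    by (simp add: head_poly_def sum.reindex)
qed

text \<open>Remove the first entry and standardize the rest. The only change is a possible descent
  at the first position, decided by \<open>less_lift_iff\<close>; n \<ge> 2 keeps the last two
  entries among the rest.\<close>

lemma head_poly_Suc:
  assumes n: "n \<ge> 2" and k: "k \<in> heads (Suc n)"
  shows "head_poly z (Suc n) k =
    threshold_sum z (head_poly z n) (heads n) {l \<in> heads n. l < k \<or> l = k \<and> k < 0}"
proof -
  have k0: "k \<noteq> 0" using k by (auto simp: heads_def)
  have "tail_des (k # map (lift k) \<tau>) = of_bool (hd \<tau> < k \<or> hd \<tau> = k \<and> k < 0) + tail_des \<tau>"
    if \<tau>: "\<tau> \<in> signed_permutations n" for \<tau>
  proof -
    have len: "length \<tau> \<ge> 2" using \<tau> n signed_permutations_length by auto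
    then have "hd (map (lift k) \<tau>) = lift k (hd \<tau>)" by (intro list.map_sel) auto
    moreover have "hd \<tau> \<noteq> 0" using hd_signed_permutations [OF \<tau>] n by (auto simp: heads_def)
    ultimately show ?thesis
      using len k0 by (simp add: tail_des_Cons tail_des_map strict_mono_lift lift_minus less_lift_iff)
  qed
  then have "head_poly z (Suc n) k = (\<Sum>\<tau>\<in>signed_permutations n. z ^ (of_bool (hd \<tau> < k \<or> hd \<tau> = k \<and> k < 0) + tail_des \<tau>))"
    unfolding head_poly_reindex [OF k] by (intro sum.cong) auto
  then show ?thesis
    using sum_by_head [of n z "\<lambda>l. l < k \<or> l = k \<and> k < 0"] n by simp
qed

subsection \<open>The initial polynomials\<close>

lemma heads_numeral:
  "heads 2 = {-2, -1, 1, 2}" "heads 3 = {-3, -2, -1, 1, 2, 3}" "heads 4 = {-4, -3, -2, -1, 1, 2, 3, 4}"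
  by (auto simp: heads_def)

lemma head_poly_2:
  "head_poly z 2 (-2) = 2" "head_poly z 2 (-1) = 2 * z" "head_poly z 2 1 = 2 * z" "head_poly z 2 2 = 2 * z\<^sup>2"
proof -
  have sp: "signed_permutations (Suc 0) = {[1], [-1]}"
  proof -
    have "signed_permutations (Suc 0) = {\<sigma>. map abs \<sigma> = [1]}" by (simp add: signed_permutations_def)
    also have "\<dots> = {[1], [-1]}" by (auto simp: abs_if split: if_splits)
    finally show ?thesis .
  qed
  have "head_poly z (Suc (Suc 0)) k = z ^ tail_des [k, lift k 1] + z ^ tail_des [k, lift k (-1)]"
    if "k \<in> heads 2" for k
    using head_poly_reindex [of k "Suc 0" z] that by (simp add: sp numeral_2_eq_2)
  then show "head_poly z 2 (-2) = 2" "head_poly z 2 (-1) = 2 * z" "head_poly z 2 1 = 2 * z" "head_poly z 2 2 = 2 * z\<^sup>2"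
    by (simp_all add: numeral_2_eq_2 [symmetric] heads_numeral tail_des_pair lift_def)
qed

lemma head_poly_3:
  "head_poly z 3 (-3) = cubic 2 4 2 0 z" "head_poly z 3 (-2) = cubic 0 6 2 0 z"
  "head_poly z 3 (-1) = cubic 0 4 4 0 z" "head_poly z 3 1 = cubic 0 4 4 0 z"
  "head_poly z 3 2 = cubic 0 2 6 0 z" "head_poly z 3 3 = cubic 0 2 4 2 z"
  by (simp_all add: head_poly_Suc [of 2, unfolded threshold_sum_if [OF finite_heads], simplified] threshold_sum_if heads_numeral head_poly_2 cubic_def algebra_simps power2_eq_square power3_eq_cube)

text \<open>The last sum has degree 4 and is kept as \<open>z\<close> times the first one: for the
  largest head every smaller window gains a descent, for the least head none does.\<close>

lemma head_poly_4:
  "head_poly z 4 (-4) = cubic 2 22 22 2 z" "head_poly z 4 (-3) = cubic 0 20 24 4 z"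
  "head_poly z 4 (-2) = cubic 0 14 28 6 z" "head_poly z 4 (-1) = cubic 0 10 28 10 z"
  "head_poly z 4 1 = cubic 0 10 28 10 z" "head_poly z 4 2 = cubic 0 6 28 14 z"
  "head_poly z 4 3 = cubic 0 4 24 20 z" "head_poly z 4 4 = z * cubic 2 22 22 2 z"
  by (simp_all add: head_poly_Suc [of 3, unfolded threshold_sum_if [OF finite_heads], simplified] threshold_sum_if heads_numeral head_poly_3 cubic_def algebra_simps power2_eq_square power3_eq_cube)

lemma interlace_at_head_poly_4:
  assumes z: "0 \<le> Im z" and kl: "k \<in> heads 4" "l \<in> heads 4" "k \<le> l"
  shows "interlace_at z (head_poly z 4 k) (head_poly z 4 l)"
proof -
  have cub: "interlace_at z (cubic 2 22 22 2 z) (cubic 0 20 24 4 z)"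
    "interlace_at z (cubic 2 22 22 2 z) (cubic 0 14 28 6 z)"
    "interlace_at z (cubic 2 22 22 2 z) (cubic 0 10 28 10 z)"
    "interlace_at z (cubic 2 22 22 2 z) (cubic 0 6 28 14 z)"
    "interlace_at z (cubic 2 22 22 2 z) (cubic 0 4 24 20 z)"
    by (rule interlace_at_cubic [OF z]; simp add: bezoutian_nonneg_def)+
  have quad: "interlace_at z (cubic 0 20 24 4 z) (cubic 0 14 28 6 z)"
    "interlace_at z (cubic 0 20 24 4 z) (cubic 0 10 28 10 z)"
    "interlace_at z (cubic 0 20 24 4 z) (cubic 0 6 28 14 z)"
    "interlace_at z (cubic 0 20 24 4 z) (cubic 0 4 24 20 z)"
    "interlace_at z (cubic 0 14 28 6 z) (cubic 0 10 28 10 z)"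
    "interlace_at z (cubic 0 14 28 6 z) (cubic 0 6 28 14 z)"
    "interlace_at z (cubic 0 14 28 6 z) (cubic 0 4 24 20 z)"
    "interlace_at z (cubic 0 10 28 10 z) (cubic 0 6 28 14 z)"
    "interlace_at z (cubic 0 10 28 10 z) (cubic 0 4 24 20 z)"
    "interlace_at z (cubic 0 6 28 14 z) (cubic 0 4 24 20 z)"
    by (rule interlace_at_quadratic [OF z]; simp add: bezoutian_nonneg_def)+
  \<comment> \<open>Coinciding sums, such as those for -1 and 1, use reflexivity; pairs ending in
    head 4 come from pairs starting in head -4 by \<open>interlace_at_shifted\<close>.\<close>
  note refl = interlace_at_refl [OF z]
  show ?thesis
    using kl unfolding heads_numeral
    by (elim insertE emptyE)
      (simp_all add: head_poly_4 refl cub quad cub [THEN interlace_at_shifted] refl [THEN interlace_at_shifted])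
qed

lemma head_poly_4_nonzero:
  assumes z: "0 < Im z"
  shows "head_poly z 4 (-4) \<noteq> 0"
proof
  assume "head_poly z 4 (-4) = 0"
  then have "2 * ((z + 1) * (z\<^sup>2 + 10 * z + 1)) = 0"
    by (simp add: head_poly_4 cubic_def algebra_simps power2_eq_square power3_eq_cube)
  then have "z = - 1 \<or> z\<^sup>2 + 10 * z + 1 = 0"
    by (simp add: eq_neg_iff_add_eq_0)
  then show False
  proof
    assume eq: "z\<^sup>2 + 10 * z + 1 = 0"
    \<comment> \<open>The roots are real: off the real axis the imaginary part fixes Re z, and the
      real part then makes a square negative.\<close>
    have "Im (z\<^sup>2 + 10 * z + 1) = 2 * Im z * (Re z + 5)"
      by (simp add: power2_eq_square algebra_simps)
    then have "Re z = - 5" using z eq by simp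
    moreover have "Re (z\<^sup>2 + 10 * z + 1) = (Re z)\<^sup>2 - (Im z)\<^sup>2 + 10 * Re z + 1"
      by (simp add: power2_eq_square)
    ultimately have "(Im z)\<^sup>2 = - 24" using eq by simp
    then show False by (smt (verit) zero_le_power2)
  qed (use z in simp)
qed

subsection \<open>Real-rootedness\<close>

text \<open>Nonvanishing at the least head joins the induction because interlacing alone admits zero
  values.\<close>

lemma interlace_at_head_poly:
  assumes z: "0 < Im z" and n: "4 \<le> n"
  shows "(\<forall>k\<in>heads n. \<forall>l\<in>heads n. k \<le> l \<longrightarrow> interlace_at z (head_poly z n k) (head_poly z n l))
    \<and> head_poly z n (- int n) \<noteq> 0"
  using n
proof (induction n rule: dec_induct)
  case base
  then show ?case
    using interlace_at_head_poly_4 head_poly_4_nonzero z by auto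
next
  case (step n)
  have n: "n \<ge> 2" using step.hyps by simp
  \<comment> \<open>The sets of heads that receive the factor \<open>z\<close> are initial segments
    of \<open>heads n\<close> and grow with the new head.\<close>
  have "interlace_at z (head_poly z (Suc n) k) (head_poly z (Suc n) l)"
    if kl: "k \<in> heads (Suc n)" "l \<in> heads (Suc n)" "k \<le> l" for k l
    unfolding head_poly_Suc [OF n kl(1)] head_poly_Suc [OF n kl(2)]
    by (rule interlace_at_threshold_sum) (use z step.IH \<open>k \<le> l\<close> in auto)
  moreover have "head_poly z (Suc n) (- int (Suc n)) \<noteq> 0"
  proof -
    \<comment> \<open>No head lies below the new least one, so its sum is the plain total of the
      previous sums.\<close>
    have "{l \<in> heads n. l < - int (Suc n) \<or> l = - int (Suc n) \<and> - int (Suc n) < 0} = {}"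
      by (auto simp: heads_def)
    moreover have "- int (Suc n) \<in> heads (Suc n)"
      by (simp add: heads_def)
    ultimately have "head_poly z (Suc n) (- int (Suc n)) = (\<Sum>l\<in>heads n. head_poly z n l)"
      using head_poly_Suc [OF n, of "- int (Suc n)" z] by (simp only: threshold_sum_def) simp
    also have "\<dots> \<noteq> 0"
      by (rule sum_nonzero_of_interlace_at [OF z finite_heads, of "- int n"])
        (use step.IH n in \<open>auto simp: heads_def\<close>)
    finally show ?thesis .
  qed
  ultimately show ?case by blast
qed

lemma threshold_sum_head_poly_nonzero:
  assumes z: "0 < Im z" and n: "2 \<le> n"
  shows "threshold_sum z (head_poly z n) (heads n) {k \<in> heads n. k < 0} \<noteq> 0"
proof -
  consider "n = 2" | "n = 3" | "4 \<le> n" using n by linarith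
  then show ?thesis
  proof cases
    case 1
    have "threshold_sum z (head_poly z 2) (heads 2) {k \<in> heads 2. k < 0} = 4 * z * (z + 1)"
      by (simp add: threshold_sum_if) (simp add: heads_numeral head_poly_2 algebra_simps power2_eq_square)
    moreover have "z \<noteq> 0" "z + 1 \<noteq> 0" using z by (auto simp: complex_eq_iff)
    ultimately show ?thesis using 1 by simp
  next
    case 2
    have "threshold_sum z (head_poly z 3) (heads 3) {k \<in> heads 3. k < 0} = 2 * z * (5 * z\<^sup>2 + 14 * z + 5)"
      by (simp add: threshold_sum_if)
        (simp add: heads_numeral head_poly_3 cubic_def algebra_simps power2_eq_square power3_eq_cube)
    moreover have "5 * z\<^sup>2 + 14 * z + 5 \<noteq> 0"
    proof
      assume eq: "5 * z\<^sup>2 + 14 * z + 5 = 0"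
      \<comment> \<open>Again a quadratic with positive discriminant, excluded through its imaginary
        and real parts.\<close>
      have "Im (5 * z\<^sup>2 + 14 * z + 5) = 2 * Im z * (5 * Re z + 7)"
        by (simp add: power2_eq_square algebra_simps)
      then have "Re z = - 7 / 5" using z eq by simp
      moreover have "Re (5 * z\<^sup>2 + 14 * z + 5) = 5 * (Re z)\<^sup>2 - 5 * (Im z)\<^sup>2 + 14 * Re z + 5"
        by (simp add: power2_eq_square)
      ultimately have "5 * (- 7 / 5)\<^sup>2 - 5 * (Im z)\<^sup>2 + 14 * (- 7 / 5) + 5 = 0"
        unfolding eq by simp
      then have "25 * (Im z)\<^sup>2 = - 24" by (simp add: power2_eq_square)
      then show False by (smt (verit) zero_le_power2)
    qed
    ultimately show ?thesis using 2 z by auto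
  next
    case 3
    show ?thesis
      by (rule threshold_sum_nonzero [OF z finite_heads, of _ _ "- int n"])
        (use interlace_at_head_poly [OF z 3] n in \<open>auto simp: heads_def\<close>)
  qed
qed

text \<open>The first summand of \<open>affine_des_B\<close> contributes a factor \<open>z\<close>
  exactly at negative heads.\<close>

lemma poly_affine_eulerian_B:
  assumes "2 \<le> n"
  shows "poly (map_poly of_real (affine_eulerian_B n)) z =
    threshold_sum z (head_poly z n) (heads n) {k \<in> heads n. k < 0}"
proof -
  have "map_poly of_real (affine_eulerian_B n) = (\<Sum>\<sigma>\<in>signed_permutations n. monom 1 (affine_des_B \<sigma>) :: complex poly)"
    by (rule poly_eqI) (auto simp: affine_eulerian_B_def coeff_map_poly coeff_sum intro!: sum.cong)
  then have "poly (map_poly of_real (affine_eulerian_B n)) z = (\<Sum>\<sigma>\<in>signed_permutations n. z ^ affine_des_B \<sigma>)"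
    by (simp add: poly_sum poly_monom)
  also have "\<dots> = (\<Sum>\<sigma>\<in>signed_permutations n. z ^ (of_bool (hd \<sigma> < 0) + tail_des \<sigma>))"
  proof (intro sum.cong refl)
    fix \<sigma> assume "\<sigma> \<in> signed_permutations n"
    then have "\<sigma> \<noteq> []" using signed_permutations_length assms by fastforce
    then show "z ^ affine_des_B \<sigma> = z ^ (of_bool (hd \<sigma> < 0) + tail_des \<sigma>)"
      by (simp add: affine_des_B_eq hd_conv_nth)
  qed
  also have "\<dots> = threshold_sum z (head_poly z n) (heads n) {k \<in> heads n. k < 0}"
    using assms by (intro sum_by_head) simp
  finally show ?thesis .
qed

theorem corollary3p18:
  fixes n :: nat
  assumes "n \<ge> 2"
  shows "has_only_real_roots (affine_eulerian_B n)"
  unfolding has_only_real_roots_def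
proof (intro allI impI)
  let ?p = "map_poly complex_of_real (affine_eulerian_B n)"
  fix z :: complex
  assume root: "poly ?p z = 0"
  have upper: "poly ?p w \<noteq> 0" if "0 < Im w" for w
    using threshold_sum_head_poly_nonzero [OF that assms] poly_affine_eulerian_B [OF assms] by metis
  \<comment> \<open>Real coefficients reflect a root in the lower half-plane into the upper
    one.\<close>
  have "poly ?p (cnj z) = cnj (poly ?p z)"
    by (subst poly_cnj_real) (simp_all add: coeff_map_poly)
  then have "poly ?p (cnj z) = 0" using root by simp
  then have "\<not> 0 < Im z" "\<not> 0 < Im (cnj z)" using upper root by blast+
  then show "z \<in> \<real>" by (simp add: complex_is_Real_iff)
qed

end
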